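(* $\Xi_{5,5}\ge38$; that is, there exists a system of $5$ polynomial equations in $5$ variables with real coefficients, involving at most $11$ monomials in total, which has at least $38$ non-degenerate solutions in the positive orthant.
   Context: $\Xi_{d,k}$ denotes the maximum number of non-degenerate solutions (invertible Jacobian matrix) with all coordinates real and positive, over all polynomial systems of $d$ equations in $d$ variables with real coefficients involving at most $d+k+1$ monomials. *)

theory Defs
  imports "HOL-Analysis.Analysis" "HOL-Library.Poly_Mapping" "HOL-Library.Extended_Nat"
begin

text \<open>
  Real polynomials in the variables indexed by a finite type \<open>'d\<close> are finitely supported
  maps from exponent vectors to coefficients. The support \<open>Poly_Mapping.keys p\<close> is the set of
  monomials occurring in \<open>p\<close> with non-zero coefficient.
\<close>

type_synonym 'd real_mpoly = "('d \<Rightarrow>\<^sub>0 nat) \<Rightarrow>\<^sub>0 real"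

definition eval_monom :: "('d::finite \<Rightarrow>\<^sub>0 nat) \<Rightarrow> real ^ 'd \<Rightarrow> real" where
  "eval_monom m x = (\<Prod>j\<in>UNIV. (x $ j) ^ Poly_Mapping.lookup m j)"

definition eval_mpoly :: "'d::finite real_mpoly \<Rightarrow> real ^ 'd \<Rightarrow> real" where
  "eval_mpoly p x = (\<Sum>m\<in>Poly_Mapping.keys p. Poly_Mapping.lookup p m * eval_monom m x)"

text \<open>A square system: as many equations as variables, both indexed by \<open>'d\<close>.\<close>

type_synonym 'd poly_system = "'d \<Rightarrow> 'd real_mpoly"

definition system_map :: "'d::finite poly_system \<Rightarrow> real ^ 'd \<Rightarrow> real ^ 'd" where
  "system_map F x = (\<chi> i. eval_mpoly (F i) x)"

definition system_monomials :: "'d::finite poly_system \<Rightarrow> ('d \<Rightarrow>\<^sub>0 nat) set" where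
  "system_monomials F = (\<Union>i. Poly_Mapping.keys (F i))"

definition nondeg_positive_solutions :: "'d::finite poly_system \<Rightarrow> (real ^ 'd) set" where
  "nondeg_positive_solutions F =
     {x. (\<forall>j. 0 < x $ j) \<and> system_map F x = 0 \<and> invertible (jacobian (system_map F) (at x))}"

text \<open>Cardinality with value \<open>\<infinity>\<close> on infinite sets, where \<open>card\<close> would return \<open>0\<close>.\<close>

definition ecard :: "'a set \<Rightarrow> enat" where
  "ecard A = (if finite A then enat (card A) else \<infinity>)"

text \<open>
  The number of variables \<open>d\<close> is \<open>CARD('d)\<close>. By Khovanskii's fewnomial bound the supremum below
  is finite, hence a maximum; taking it in \<open>enat\<close> keeps the definition meaningful without
  presupposing that theorem (on \<open>nat\<close>, suprema of unbounded sets are unspecified).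
\<close>

definition Xi :: "'d::finite itself \<Rightarrow> nat \<Rightarrow> enat" where
  "Xi _ k = (SUP F \<in> {F :: 'd poly_system. card (system_monomials F) \<le> CARD('d) + k + 1}.
               ecard (nondeg_positive_solutions F))"

end

theory Submission
  imports Defs
begin

text \<open>
  The lower bound is witnessed by a system whose solutions are all rational. A product
  construction gives many solutions with few monomials: systems in disjoint sets of variables
  can share their constant monomial, and their solution counts multiply. Three copies of
  \<open>(z - 1) (z - 2) = 0\<close> contribute \<open>2\<^sup>3\<close> solutions, so a system in two variables \<open>x\<close>, \<open>y\<close> with
  five monomials and five non-degenerate positive solutions is enough: together this makes
  \<open>5 * 8 = 40\<close> solutions with \<open>5 + 3 * 2 = 11\<close> monomials.

  The planar system intersects the line \<open>x + y = N\<close> with a curve that uses only two monomials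
  besides \<open>1\<close>, \<open>x\<close> and \<open>y\<close>, namely \<open>x\<^sup>3 y\<^sup>2\<close> and \<open>x\<^sup>2 y\<close>. On the line these become
  \<open>x^5 - 2 N x^4 + N\<^sup>2 x\<^sup>3\<close> and \<open>N x\<^sup>2 - x\<^sup>3\<close>. Hence a monic quintic with elementary symmetric
  functions \<open>e\<^sub>1, \<dots>, e\<^sub>5\<close> of its roots is the restriction of such a curve exactly if
  \<open>e\<^sub>1 = 2 N\<close> and \<open>e\<^sub>3 = N (e\<^sub>2 - N\<^sup>2)\<close>. For \<open>N = 15\<close> the five distinct numbers
  \<open>1, 2, 8, 9, 10\<close> between \<open>0\<close> and \<open>N\<close> satisfy both conditions, with \<open>e\<^sub>1 = 30\<close>, \<open>e\<^sub>2 = 325\<close>,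
  \<open>e\<^sub>3 = 1500\<close>, \<open>e\<^sub>4 = 2644\<close> and \<open>e\<^sub>5 = 1440\<close>. So on the line
  \<open>x\<^sup>3 y\<^sup>2 - 100 x\<^sup>2 y + 2644 x - 1440 = (x - 1) (x - 2) (x - 8) (x - 9) (x - 10)\<close>.

  The Jacobian matrix is regular because all roots are simple: a kernel vector is tangent to the
  line, on which the derivative of the quintic does not vanish at its roots, and the remaining
  components are killed by \<open>2 z - 3 \<noteq> 0\<close> (\<open>coupled_solution_nondeg\<close>).
\<close>

lemma exhaust_5: "x = 0 \<or> x = 1 \<or> x = 2 \<or> x = 3 \<or> x = 4" for x :: 5
proof (induct x)
  case (of_int z)
  then have "z = 0 \<or> z = 1 \<or> z = 2 \<or> z = 3 \<or> z = 4" by simp arith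
  then show ?case by auto
qed

lemma forall_5: "(\<forall>i::5. P i) \<longleftrightarrow> P 0 \<and> P 1 \<and> P 2 \<and> P 3 \<and> P 4"
  by (metis exhaust_5)

lemma eval_monom_single: "eval_monom (Poly_Mapping.single j e) x = (x $ j) ^ e"
proof -
  have "eval_monom (Poly_Mapping.single j e) x = (\<Prod>k\<in>UNIV. if k = j then (x $ j) ^ e else 1)"
    unfolding eval_monom_def by (intro prod.cong) (auto simp: lookup_single when_def)
  then show ?thesis by simp
qed

lemma eval_monom_0: "eval_monom 0 x = 1"
  by (simp add: eval_monom_def)

lemma eval_monom_add: "eval_monom (m + n) x = eval_monom m x * eval_monom n x"
  by (simp add: eval_monom_def lookup_add power_add prod.distrib)

text \<open>
  Cancellation can make the support of a sum smaller than the union of the supports; enlarging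
  the index set lets all sums range over one common set.
\<close>

lemma eval_mpoly_superset:
  assumes "finite S" "Poly_Mapping.keys p \<subseteq> S"
  shows "eval_mpoly p x = (\<Sum>m\<in>S. Poly_Mapping.lookup p m * eval_monom m x)"
  unfolding eval_mpoly_def using assms
  by (intro sum.mono_neutral_left) (auto simp: in_keys_iff)

lemma eval_mpoly_add: "eval_mpoly (p + q) x = eval_mpoly p x + eval_mpoly q x"
proof -
  let ?S = "Poly_Mapping.keys p \<union> Poly_Mapping.keys q"
  have "Poly_Mapping.keys (p + q) \<subseteq> ?S" by (rule keys_add)
  then show ?thesis
    by (simp add: eval_mpoly_superset[where S = ?S] lookup_add distrib_right sum.distrib)
qed

lemma eval_mpoly_single: "eval_mpoly (Poly_Mapping.single m c) x = c * eval_monom m x"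
  by (simp add: eval_mpoly_def)

lemma invertible_jacobianI:
  fixes f :: "real ^ 'n \<Rightarrow> real ^ 'n"
  assumes D: "(f has_derivative D) (at x)" and ker: "\<And>v. D v = 0 \<Longrightarrow> v = 0"
  shows "invertible (jacobian f (at x))"
proof -
  have "linear D" using D by (rule has_derivative_linear)
  then have "matrix D *v v = D v" for v
    by (intro matrix_works) (simp add: linear_matrix_vector_mul_eq)
  moreover have "jacobian f (at x) = matrix D"
    using frechet_derivative_at[OF D] by (simp add: jacobian_def)
  ultimately show ?thesis
    using ker by (simp add: invertible_left_inverse matrix_left_invertible_ker)
qed

text \<open>
  Coordinates \<open>0\<close> and \<open>1\<close> carry the planar system, the others one quadratic equation each.
  The coefficients in the second equation are \<open>15\<^sup>2 - e\<^sub>2\<close>, \<open>e\<^sub>4\<close> and \<open>- e\<^sub>5\<close> for the roots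
  \<open>1, 2, 8, 9, 10\<close>.
\<close>

definition coupled_system :: "5 poly_system" where
  "coupled_system i =
    (if i = 0 then
       Poly_Mapping.single (Poly_Mapping.single 0 1) 1
         + Poly_Mapping.single (Poly_Mapping.single 1 1) 1
         + Poly_Mapping.single 0 (-15)
     else if i = 1 then
       Poly_Mapping.single (Poly_Mapping.single 0 3 + Poly_Mapping.single 1 2) 1
         + Poly_Mapping.single (Poly_Mapping.single 0 2 + Poly_Mapping.single 1 1) (-100)
         + Poly_Mapping.single (Poly_Mapping.single 0 1) 2644
         + Poly_Mapping.single 0 (-1440)
     else
       Poly_Mapping.single (Poly_Mapping.single i 2) 1
         + Poly_Mapping.single (Poly_Mapping.single i 1) (-3)
         + Poly_Mapping.single 0 2)"

lemma system_map_coupled_system: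
  "system_map coupled_system x =
    (\<chi> i. if i = 0 then x $ 0 + x $ 1 - 15
         else if i = 1 then (x $ 0)^3 * (x $ 1)^2 - 100 * ((x $ 0)^2 * x $ 1) + 2644 * x $ 0 - 1440
         else (x $ i)^2 - 3 * x $ i + 2)"
  by (simp add: system_map_def coupled_system_def vec_eq_iff eval_mpoly_add eval_mpoly_single
      eval_monom_add eval_monom_single eval_monom_0 del: single_numeral)

lemma system_monomials_coupled_system:
  "card (system_monomials coupled_system) \<le> 11"
proof -
  let ?e = "Poly_Mapping.single :: 5 \<Rightarrow> nat \<Rightarrow> 5 \<Rightarrow>\<^sub>0 nat"
  define M where "M = [0, ?e 0 1, ?e 1 1, ?e 0 2 + ?e 1 1, ?e 0 3 + ?e 1 2,
     ?e 2 1, ?e 2 2, ?e 3 1, ?e 3 2, ?e 4 1, ?e 4 2]"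
  have "Poly_Mapping.keys (coupled_system i) \<subseteq> set M" for i
    using exhaust_5[of i] unfolding coupled_system_def M_def
    by (auto dest!: subsetD[OF keys_add] simp del: single_numeral split: if_splits)
  then have "system_monomials coupled_system \<subseteq> set M"
    by (auto simp: system_monomials_def)
  then have "card (system_monomials coupled_system) \<le> card (set M)"
    by (intro card_mono) auto
  also have "\<dots> \<le> length M" by (rule card_length)
  finally show ?thesis by (simp add: M_def)
qed

lemma has_derivative_system_map_coupled_system:
  "(system_map coupled_system has_derivative
    (\<lambda>v. \<chi> i. if i = 0 then v $ 0 + v $ 1
         else if i = 1 then
           (3 * (x $ 0)^2 * (x $ 1)^2 - 200 * (x $ 0 * x $ 1) + 2644) * v $ 0
             + (2 * (x $ 0)^3 * x $ 1 - 100 * (x $ 0)^2) * v $ 1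
         else (2 * x $ i - 3) * v $ i)) (at x)"
proof -
  have nth: "((\<lambda>x. x $ i) has_derivative (\<lambda>v. v $ i)) (at x)" for i and x :: "real ^ 5"
    by (rule bounded_linear_imp_has_derivative[OF bounded_linear_vec_nth])
  show ?thesis
    unfolding system_map_coupled_system [abs_def]
  proof (subst has_derivative_componentwise_within, clarsimp simp: Basis_vec_def inner_axis)
    fix i :: 5
    consider "i = 0" | "i = 1" | "i \<noteq> 0" "i \<noteq> 1" by blast
    then show "((\<lambda>x. if i = 0 then x $ 0 + x $ 1 - 15
         else if i = 1 then (x $ 0)^3 * (x $ 1)^2 - 100 * ((x $ 0)^2 * x $ 1) + 2644 * x $ 0 - 1440
         else (x $ i)^2 - 3 * x $ i + 2) has_derivative
       (\<lambda>v. if i = 0 then v $ 0 + v $ 1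
         else if i = 1 then
           (3 * (x $ 0)^2 * (x $ 1)^2 - 200 * (x $ 0 * x $ 1) + 2644) * v $ 0
             + (2 * (x $ 0)^3 * x $ 1 - 100 * (x $ 0)^2) * v $ 1
         else (2 * x $ i - 3) * v $ i)) (at x)"
      by cases (auto intro!: derivative_eq_intros nth
        simp: algebra_simps power2_eq_square power3_eq_cube)
  qed
qed

definition coupled_solution :: "real \<times> real \<times> real \<times> real \<Rightarrow> real ^ 5" where
  "coupled_solution = (\<lambda>(r, a, b, c).
     \<chi> i. if i = 0 then r else if i = 1 then 15 - r else if i = 2 then a else if i = 3 then b else c)"

lemma coupled_solution_nondeg:
  assumes "r \<in> {1, 2, 8, 9, 10}" "a \<in> {1, 2}" "b \<in> {1, 2}" "c \<in> {1, 2}"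
  shows "coupled_solution (r, a, b, c) \<in> nondeg_positive_solutions coupled_system"
proof -
  define x where "x = coupled_solution (r, a, b, c)"
  have x: "x $ 0 = r" "x $ 1 = 15 - r" "x $ 2 = a" "x $ 3 = b" "x $ 4 = c"
    by (simp_all add: x_def coupled_solution_def)
  have "\<forall>j. 0 < x $ j"
    using assms by (auto simp: forall_5 x)
  moreover have "system_map coupled_system x = 0"
    using assms by (auto simp: system_map_coupled_system vec_eq_iff forall_5 x)
  moreover have "invertible (jacobian (system_map coupled_system) (at x))"
  proof (rule invertible_jacobianI[OF has_derivative_system_map_coupled_system], goal_cases)
    case (1 v)
    then have *: "v $ 1 = - v $ 0"
      "(3 * r^2 * (15 - r)^2 - 200 * (r * (15 - r)) + 2644) * v $ 0
             + (2 * r^3 * (15 - r) - 100 * r^2) * v $ 1 = 0"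
      "(2 * a - 3) * v $ 2 = 0" "(2 * b - 3) * v $ 3 = 0" "(2 * c - 3) * v $ 4 = 0"
      by (simp_all add: vec_eq_iff forall_5 x)
    \<comment> \<open>Substituting the tangency condition leaves \<open>v $ 0\<close> times the derivative of the quintic at
      its simple root \<open>r\<close>.\<close>
    have "v $ 0 = 0" using *(1,2) assms(1) by auto
    moreover have "v $ 2 = 0" "v $ 3 = 0" "v $ 4 = 0" using *(3-5) assms(2-4) by auto
    ultimately show ?case using *(1) by (simp add: vec_eq_iff forall_5)
  qed
  ultimately show ?thesis by (simp add: nondeg_positive_solutions_def x_def)
qed

lemma le_ecard_of_subset:
  assumes "finite B" "B \<subseteq> A" "n \<le> card B"
  shows "enat n \<le> ecard A"
proof (cases "finite A")
  case True
  then show ?thesis using assms card_mono[of A B] by (simp add: ecard_def)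
qed (simp add: ecard_def)

lemma le_ecard_coupled_system: "38 \<le> ecard (nondeg_positive_solutions coupled_system)"
proof -
  define P :: "(real \<times> real \<times> real \<times> real) set"
    where "P = {1, 2, 8, 9, 10} \<times> {1, 2} \<times> {1, 2} \<times> {1, 2}"
  have "inj coupled_solution"
    by (auto simp: inj_def coupled_solution_def vec_eq_iff forall_5)
  then have "card (coupled_solution ` P) = card P"
    by (meson card_image inj_on_subset subset_UNIV)
  also have "card P = 40" by (simp add: P_def card_cartesian_product)
  finally have "38 \<le> card (coupled_solution ` P)" by simp
  moreover have "coupled_solution ` P \<subseteq> nondeg_positive_solutions coupled_system"
    using coupled_solution_nondeg unfolding P_def by blast
  ultimately have "enat 38 \<le> ecard (nondeg_positive_solutions coupled_system)"
    by (intro le_ecard_of_subset) (auto simp: P_def)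
  then show ?thesis by (simp add: numeral_eq_enat)
qed

theorem mainTheorem11:
  shows "38 \<le> Xi TYPE(5) 5 \<and>
    (\<exists>F :: 5 poly_system. card (system_monomials F) \<le> 11 \<and>
       38 \<le> ecard (nondeg_positive_solutions F))"
proof
  show "\<exists>F :: 5 poly_system. card (system_monomials F) \<le> 11 \<and>
       38 \<le> ecard (nondeg_positive_solutions F)"
    using system_monomials_coupled_system le_ecard_coupled_system by blast
  show "38 \<le> Xi TYPE(5) 5"
    unfolding Xi_def
    using system_monomials_coupled_system le_ecard_coupled_system
    by (intro SUP_upper2[of coupled_system]) auto
qed

end
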